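(* Let $G$ be a $4$-colorable nice graph. Then $G$ admits a vertex-coloring $4$-edge-weighting.
   Context: All graphs are finite, undirected and simple. A graph is nice if no connected component of it is a single edge ($K_2$). A graph is $4$-colorable if it has a proper vertex coloring with at most $4$ colors. A $k$-edge-weighting of $G$ is a map $w:E(G)\to\{1,\dots,k\}$; it is vertex-coloring if the induced map $c(u)=\sum_{e\ni u}w(e)$ (integer sum over edges $e$ incident with $u$) satisfies $c(u)\ne c(v)$ for every edge $uv\in E(G)$. *)

theory Defs
  imports Main
begin

text \<open>
  A finite simple graph is a vertex set together with a set of two-element subsets of it.
  Isolated vertices and the empty graph are allowed.
\<close>

locale simple_graph =
  fixes V :: "'a set" and E :: "'a set set"
  assumes finite_vertices: "finite V"
    and edge_subset: "e \<in> E \<Longrightarrow> e \<subseteq> V"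
    and edge_card: "e \<in> E \<Longrightarrow> card e = 2"

definition adjacency :: "'a set set \<Rightarrow> ('a \<times> 'a) set" where
  "adjacency E = {(u, v). {u, v} \<in> E}"

definition linked :: "'a set \<Rightarrow> 'a set set \<Rightarrow> ('a \<times> 'a) set" where
  "linked V E = {(u, v). u \<in> V \<and> v \<in> V \<and> (u, v) \<in> (adjacency E)\<^sup>*}"

text \<open>The vertex sets of the connected components.\<close>

definition components :: "'a set \<Rightarrow> 'a set set \<Rightarrow> 'a set set" where
  "components V E = V // linked V E"

definition induced_edges :: "'a set set \<Rightarrow> 'a set \<Rightarrow> 'a set set" where
  "induced_edges E C = {e \<in> E. e \<subseteq> C}"

definition is_K2 :: "'a set \<Rightarrow> 'a set set \<Rightarrow> bool" where
  "is_K2 V E \<longleftrightarrow> (\<exists>u v. u \<noteq> v \<and> V = {u, v} \<and> E = {{u, v}})"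

definition nice :: "'a set \<Rightarrow> 'a set set \<Rightarrow> bool" where
  "nice V E \<longleftrightarrow> (\<forall>C \<in> components V E. \<not> is_K2 C (induced_edges E C))"

definition proper_coloring :: "'a set set \<Rightarrow> ('a \<Rightarrow> nat) \<Rightarrow> bool" where
  "proper_coloring E f \<longleftrightarrow> (\<forall>u v. {u, v} \<in> E \<longrightarrow> f u \<noteq> f v)"

definition colorable :: "nat \<Rightarrow> 'a set \<Rightarrow> 'a set set \<Rightarrow> bool" where
  "colorable k V E \<longleftrightarrow> (\<exists>f. f ` V \<subseteq> {..<k} \<and> proper_coloring E f)"

text \<open>Only the values of a weighting on \<open>E\<close> matter.\<close>

definition edge_weighting :: "nat \<Rightarrow> 'a set set \<Rightarrow> ('a set \<Rightarrow> nat) \<Rightarrow> bool" where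
  "edge_weighting k E w \<longleftrightarrow> (\<forall>e \<in> E. w e \<in> {1..k})"

definition weighted_degree :: "'a set set \<Rightarrow> ('a set \<Rightarrow> nat) \<Rightarrow> 'a \<Rightarrow> nat" where
  "weighted_degree E w u = (\<Sum>e \<in> {e \<in> E. u \<in> e}. w e)"

definition vertex_coloring_weighting :: "'a set set \<Rightarrow> ('a set \<Rightarrow> nat) \<Rightarrow> bool" where
  "vertex_coloring_weighting E w \<longleftrightarrow> proper_coloring E (weighted_degree E w)"

lemma equiv_linked: "equiv V (linked V E)"
proof -
  have "sym (adjacency E)"
    by (auto simp: adjacency_def insert_commute intro!: symI)
  then have "sym ((adjacency E)\<^sup>*)"
    by (rule sym_rtrancl)
  then show ?thesis
    by (intro equivI) (auto simp: linked_def refl_on_def sym_def trans_def)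
qed

lemma (in simple_graph) finite_edges: "finite E"
  using finite_vertices edge_subset by (auto intro: finite_subset[of E "Pow V"])

end

theory Submission
  imports Defs "HOL-Number_Theory.Cong"
begin

text \<open>
  It suffices to work modulo 4: integer weights can be replaced by their representatives in
  \<open>{1..4}\<close>, and vertices whose sums differ modulo 4 certainly have different sums.  So the
  question is which functions \<open>t\<close> on the vertices are attained modulo 4 as vertex sums.

  These functions form a group (\<open>attainable_combine\<close>), which contains \<open>\<delta> u + \<delta> v\<close> for every edge
  \<open>uv\<close>, where \<open>\<delta> u\<close> is the unit function at \<open>u\<close>.  Walking along a path from a root \<open>r\<close> to \<open>v\<close>
  shows that \<open>\<delta> v\<close> is congruent to \<open>\<delta> r\<close> or to \<open>- \<delta> r\<close> modulo the group
  (\<open>attainable_walk\<close>).  Write \<open>s v\<close> for such a sign.  A function \<open>t\<close> on the component of \<open>r\<close> is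
  then attained as soon as \<open>(\<Sum>v. s v * t v) \<cdot> \<delta> r\<close> is (\<open>attainable_if_root\<close>), and on each
  component it remains to find a \<open>t\<close> that separates adjacent vertices and for which this single
  multiple of \<open>\<delta> r\<close> is attained.

  If \<open>2 \<cdot> \<delta> r\<close> is attained (as happens when the component has an odd cycle), the sum of \<open>t\<close> only
  has to be even.  Let \<open>t\<close> be the given colouring with its colours renamed injectively to the
  residues \<open>0, 1, 2, 3\<close>.  The parity of its sum is that of the number of vertices in the two
  classes that receive odd residues, and among any three classes two have sizes of equal parity
  (\<open>even_sum_recoloring\<close>).

  Otherwise the two endpoints of each edge have opposite signs, so the signs are a bipartition.
  The component is not \<open>K\<^sub>2\<close>, so, unless it has no edge, it has at least three vertices and
  some side \<open>D\<close> contains two vertices \<open>x\<close> and \<open>y\<close>.  Let \<open>t\<close> be 2 on the other side and 0 on \<open>D\<close>,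
  except that \<open>x\<close> and \<open>y\<close> get 1 if the other side has odd size.  The signed sum is then a multiple
  of 4 (\<open>balanced_bipartite_target\<close>).
\<close>

section \<open>Attainable vertex sums modulo k\<close>

text \<open>
  The vertex \<open>u\<close> ranges over the whole type.  Outside the graph the sum is empty, so an attainable
  function vanishes modulo \<open>k\<close> there, and targets on a component are extended by 0.
\<close>

definition attainable :: "int \<Rightarrow> 'a set set \<Rightarrow> ('a \<Rightarrow> int) \<Rightarrow> bool" where
  "attainable k E t \<longleftrightarrow>
    (\<exists>w :: 'a set \<Rightarrow> int. \<forall>u. [(\<Sum>e \<in> {e \<in> E. u \<in> e}. w e) = t u] (mod k))"

definition \<delta> :: "'a \<Rightarrow> 'a \<Rightarrow> int" where
  "\<delta> u x = of_bool (x = u)"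

lemma attainable_zero: "attainable k E (\<lambda>x. 0)"
  unfolding attainable_def by (rule exI[of _ "\<lambda>e. 0"]) simp

lemma attainable_combine:
  assumes "attainable k E t" "attainable k E t'"
  shows "attainable k E (\<lambda>x. a * t x + b * t' x)"
proof -
  obtain w w' :: "'a set \<Rightarrow> int"
    where w: "\<And>u. [(\<Sum>e \<in> {e \<in> E. u \<in> e}. w e) = t u] (mod k)"
      and w': "\<And>u. [(\<Sum>e \<in> {e \<in> E. u \<in> e}. w' e) = t' u] (mod k)"
    using assms unfolding attainable_def by blast
  have "[(\<Sum>e \<in> {e \<in> E. u \<in> e}. a * w e + b * w' e) = a * t u + b * t' u] (mod k)" for u
    unfolding sum.distrib sum_distrib_left[symmetric]
    by (intro cong_add cong_mult cong_refl w w')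
  then show ?thesis
    unfolding attainable_def by (intro exI[of _ "\<lambda>e. a * w e + b * w' e"]) blast
qed

lemma attainable_scale:
  "attainable k E t \<Longrightarrow> attainable k E (\<lambda>x. a * t x)"
  using attainable_combine[of k E t t a 0] by simp

lemma attainable_sum:
  assumes "finite A" "\<And>i. i \<in> A \<Longrightarrow> attainable k E (t i)"
  shows "attainable k E (\<lambda>x. \<Sum>i\<in>A. t i x)"
  using assms
proof (induction A rule: finite_induct)
  case empty
  show ?case by (simp add: attainable_zero)
next
  case (insert i A)
  then show ?case
    using attainable_combine[of k E "t i" "\<lambda>x. \<Sum>i\<in>A. t i x" 1 1] by simp
qed

lemma attainable_multiple:
  assumes "k dvd c"
  shows "attainable k E (\<lambda>x. c * t x)"
  unfolding attainable_def using assms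
  by (intro exI[of _ "\<lambda>e. 0"]) (simp add: cong_0_iff cong_sym_eq[of 0])

lemma attainable_edge:
  assumes "finite E" "{u, v} \<in> E" "u \<noteq> v"
  shows "attainable k E (\<lambda>x. \<delta> u x + \<delta> v x)"
proof -
  have "(\<Sum>e \<in> {e \<in> E. x \<in> e}. of_bool (e = {u, v})) = \<delta> u x + \<delta> v x" for x
    using assms by (auto simp: \<delta>_def of_bool_def sum.delta)
  then show ?thesis
    unfolding attainable_def by (intro exI[of _ "\<lambda>e. of_bool (e = {u, v})"]) simp
qed

text \<open>
  Alternating \<open>+1\<close> and \<open>-1\<close> along a walk cancels at all inner vertices; the sign at the root
  records the parity of the length of the walk.
\<close>

lemma attainable_walk:
  assumes "simple_graph V E" "(r, v) \<in> (adjacency E)\<^sup>*"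
  shows "\<exists>s \<in> {1, -1}. attainable k E (\<lambda>x. \<delta> v x - s * \<delta> r x)"
  using assms(2)
proof (induction rule: rtrancl_induct)
  case base
  show ?case by (rule bexI[of _ 1]) (simp_all add: attainable_zero)
next
  case (step v v')
  interpret simple_graph V E by fact
  from step.IH obtain s
    where s: "s \<in> {1, -1}" "attainable k E (\<lambda>x. \<delta> v x - s * \<delta> r x)" by blast
  have e: "{v, v'} \<in> E" using step.hyps by (simp add: adjacency_def)
  then have "v \<noteq> v'" using edge_card by fastforce
  from attainable_combine[OF attainable_edge[OF finite_edges e this] s(2), of 1 "-1"]
  have "attainable k E (\<lambda>x. \<delta> v' x - (- s) * \<delta> r x)"
    by (simp add: algebra_simps)
  then show ?case
    using s(1) by (intro bexI[of _ "- s"]) auto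
qed

text \<open>
  Each \<open>\<delta> v\<close> with \<open>v \<in> C\<close> may be traded for \<open>s v * \<delta> r\<close>, which turns \<open>t = (\<Sum>v\<in>C. t v * \<delta> v)\<close> into
  a multiple of \<open>\<delta> r\<close>.
\<close>

lemma attainable_if_root:
  assumes "finite C"
    and s: "\<And>v. v \<in> C \<Longrightarrow> attainable k E (\<lambda>x. \<delta> v x - s v * \<delta> r x)"
    and root: "attainable k E (\<lambda>x. (\<Sum>v\<in>C. s v * t v) * \<delta> r x)"
  shows "attainable k E (\<lambda>x. if x \<in> C then t x else 0)"
proof -
  have "attainable k E (\<lambda>x. \<Sum>v\<in>C. t v * (\<delta> v x - s v * \<delta> r x))"
    using assms(1) by (intro attainable_sum attainable_scale s)
  from attainable_combine[OF this root, of 1 1]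
  have "attainable k E (\<lambda>x. \<Sum>v\<in>C. t v * \<delta> v x)"
    by (simp add: algebra_simps sum_subtractf sum_distrib_left sum_distrib_right)
  moreover have "(\<Sum>v\<in>C. t v * \<delta> v x) = (if x \<in> C then t x else 0)" for x
    using \<open>finite C\<close> by (auto simp: \<delta>_def of_bool_def if_distrib sum.delta cong: if_cong)
  ultimately show ?thesis by simp
qed

section \<open>Targets that separate adjacent vertices\<close>

text \<open>
  In the three renamings below, the pairs of colours with an odd image are \<open>{0, 1}\<close>, \<open>{0, 2}\<close> and
  \<open>{1, 2}\<close>.  Each colour lies in an even number of these pairs, so the three sums cannot all be
  odd.
\<close>

lemma even_sum_recoloring:
  fixes f :: "'a \<Rightarrow> nat"
  assumes "f ` C \<subseteq> {..<4}"
  shows "\<exists>p :: nat \<Rightarrow> int. inj_on p {..<4} \<and> p ` {..<4} \<subseteq> {0..<4} \<and> even (\<Sum>v\<in>C. p (f v))"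
proof -
  define p1 p2 p3 :: "nat \<Rightarrow> int"
    where "p1 = (!) [1, 3, 0, 2]" and "p2 = (!) [1, 0, 3, 2]" and "p3 = (!) [0, 1, 3, 2]"
  note p_defs = p1_def p2_def p3_def
  have four: "{..<4} = {0, 1, 2, 3 :: nat}" by auto
  have "even (p1 c + p2 c + p3 c)" if "c < 4" for c
  proof -
    have "c = 0 \<or> c = 1 \<or> c = 2 \<or> c = 3" using that by linarith
    then show ?thesis by (auto simp: p_defs)
  qed
  then have "even (\<Sum>v\<in>C. p1 (f v) + p2 (f v) + p3 (f v))"
    using assms by (intro dvd_sum) auto
  then have "even (\<Sum>v\<in>C. p1 (f v)) \<or> even (\<Sum>v\<in>C. p2 (f v)) \<or> even (\<Sum>v\<in>C. p3 (f v))"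
    by (auto simp: sum.distrib)
  moreover have "inj_on p {..<4} \<and> p ` {..<4} \<subseteq> {0..<4}" if "p \<in> {p1, p2, p3}" for p
    using that unfolding four by (auto simp: p_defs)
  ultimately show ?thesis by blast
qed

text \<open>
  Two 1s on the side \<open>D\<close> of \<open>x\<close> and \<open>y\<close> contribute \<open>\<plusminus> 2\<close> to the signed sum, which is what an odd
  number of 2s on the other side leaves over modulo 4.  No value on \<open>D\<close> is congruent to 2.
\<close>

lemma balanced_bipartite_target:
  fixes s :: "'a \<Rightarrow> int"
  assumes "finite C" and s: "\<And>v. v \<in> C \<Longrightarrow> s v \<in> {1, -1}"
    and xy: "x \<in> C" "y \<in> C" "x \<noteq> y" "s x = s y"
  shows "\<exists>t. 4 dvd (\<Sum>v\<in>C. s v * t v) \<and>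
    (\<forall>u\<in>C. \<forall>v\<in>C. s u \<noteq> s v \<longrightarrow> \<not> [t u = t v] (mod 4))"
proof -
  define D where "D = {v \<in> C. s v = s x}"
  define parity :: int where "parity = of_bool (odd (card (C - D)))"
  define t where "t v = (if v \<in> D then parity * (\<delta> x v + \<delta> y v) else 2)" for v
  have D: "D \<subseteq> C" "x \<in> D" "y \<in> D" "finite D" using xy \<open>finite C\<close> by (auto simp: D_def)
  have "(\<Sum>v\<in>D. \<delta> z v) = 1" if "z \<in> D" for z
    using that D(4) by (simp add: \<delta>_def of_bool_def sum.delta)
  then have "(\<Sum>v\<in>D. s v * t v) = s x * (2 * parity)"
    using D by (simp add: t_def D_def sum_distrib_left[symmetric] sum.distrib)
  moreover have "s v = - s x" if "v \<in> C - D" for v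
    using that s[of v] s[of x] xy(1) by (auto simp: D_def)
  then have "(\<Sum>v\<in>C - D. s v * t v) = (\<Sum>v\<in>C - D. - s x * 2)"
    by (intro sum.cong) (auto simp: t_def)
  ultimately have "(\<Sum>v\<in>C. s v * t v) = s x * (2 * (parity - int (card (C - D))))"
    using sum.subset_diff[OF D(1) \<open>finite C\<close>, of "\<lambda>v. s v * t v"] by (simp add: algebra_simps)
  moreover have "even (parity - int (card (C - D)))"
    by (simp add: parity_def)
  then have "2 * 2 dvd 2 * (parity - int (card (C - D)))"
    by (intro mult_dvd_mono) simp_all
  ultimately have "4 dvd (\<Sum>v\<in>C. s v * t v)"
    by (simp add: dvd_mult)
  moreover have "\<not> [t u = t v] (mod 4)" if "u \<in> C" "v \<in> C" "s u \<noteq> s v" for u v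
  proof -
    have "u \<in> D \<longleftrightarrow> v \<notin> D" using that s[of u] s[of v] s[OF xy(1)] by (auto simp: D_def)
    moreover have "t z \<in> {0, 1}" if "z \<in> D" for z
      using xy(3) that by (auto simp: t_def parity_def \<delta>_def)
    moreover have "t z = 2" if "z \<notin> D" for z
      using that by (simp add: t_def)
    ultimately show ?thesis
      by (cases "u \<in> D") (force simp: cong_def)+
  qed
  ultimately show ?thesis by blast
qed

section \<open>A single component\<close>

lemma component_target:
  assumes "simple_graph V E" "C \<in> components V E" "\<not> is_K2 C (induced_edges E C)"
    and "colorable 4 V E"
  shows "\<exists>t. attainable 4 E t \<and> (\<forall>x. x \<notin> C \<longrightarrow> t x = 0) \<and>
    (\<forall>u\<in>C. \<forall>v\<in>C. {u, v} \<in> E \<longrightarrow> \<not> [t u = t v] (mod 4))"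
proof -
  interpret simple_graph V E by fact
  obtain r where r: "r \<in> V" "C = linked V E `` {r}"
    using assms(2) by (auto simp: components_def quotient_def)
  then have reach: "(r, v) \<in> (adjacency E)\<^sup>*" if "v \<in> C" for v
    using that by (auto simp: linked_def)
  have CV: "C \<subseteq> V" using r by (auto simp: linked_def)
  then have "finite C" using finite_vertices finite_subset by blast
  have loopless: "u \<noteq> v" if "{u, v} \<in> E" for u v
    using edge_card[OF that] by auto
  have "\<forall>v\<in>C. \<exists>s. s \<in> {1, -1} \<and> attainable 4 E (\<lambda>x. \<delta> v x - s * \<delta> r x)"
    using attainable_walk[OF assms(1) reach] by blast
  from bchoice[OF this] obtain s where s: "\<And>v. v \<in> C \<Longrightarrow> s v \<in> {1, -1}"
    and walk: "\<And>v. v \<in> C \<Longrightarrow> attainable 4 E (\<lambda>x. \<delta> v x - s v * \<delta> r x)"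
    by blast
  \<comment> \<open>A separating target with attainable signed sum may be cut off outside the component.\<close>
  have cut: ?thesis
    if "attainable 4 E (\<lambda>x. (\<Sum>v\<in>C. s v * t v) * \<delta> r x)"
      and "\<forall>u\<in>C. \<forall>v\<in>C. {u, v} \<in> E \<longrightarrow> \<not> [t u = t v] (mod 4)" for t
    using attainable_if_root[OF \<open>finite C\<close> walk that(1)] that(2)
    by (intro exI[of _ "\<lambda>x. if x \<in> C then t x else 0"]) simp
  show ?thesis
  proof (cases "attainable 4 E (\<lambda>x. 2 * \<delta> r x)")
    case True
    obtain f where f: "f ` V \<subseteq> {..<4}" "proper_coloring E f"
      using assms(4) by (auto simp: colorable_def)
    have "f ` C \<subseteq> {..<4}" using f(1) CV by blast
    from even_sum_recoloring[OF this] obtain p :: "nat \<Rightarrow> int"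
      where p: "inj_on p {..<4}" "p ` {..<4} \<subseteq> {0..<4}" "even (\<Sum>v\<in>C. p (f v))" by blast
    \<comment> \<open>signs do not change parities\<close>
    have "even (\<Sum>v\<in>C. s v * p (f v) - p (f v))"
      using s by (intro dvd_sum) fastforce
    then have "even (\<Sum>v\<in>C. s v * p (f v))"
      using p(3) by (simp add: sum_subtractf)
    then obtain m where "(\<Sum>v\<in>C. s v * p (f v)) = 2 * m" by (elim evenE)
    then have "attainable 4 E (\<lambda>x. (\<Sum>v\<in>C. s v * p (f v)) * \<delta> r x)"
      using attainable_scale[OF True, of m] by (simp add: mult.assoc mult.left_commute)
    moreover have "\<not> [p (f u) = p (f v)] (mod 4)" if "u \<in> C" "v \<in> C" "{u, v} \<in> E" for u v
    proof -
      have "f u < 4" "f v < 4"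
        using that(1,2) \<open>f ` C \<subseteq> {..<4}\<close> by blast+
      moreover have "f u \<noteq> f v"
        using that(3) f(2) by (simp add: proper_coloring_def)
      ultimately have "p (f u) \<noteq> p (f v)" "p (f u) \<in> {0..<4}" "p (f v) \<in> {0..<4}"
        using p(1,2) by (auto dest: inj_onD)
      then show ?thesis by (simp add: cong_def)
    qed
    ultimately show ?thesis by (intro cut) auto
  next
    case False
    \<comment> \<open>An edge between vertices of equal sign closes an odd walk, hence yields \<open>2 * \<delta> r\<close>.\<close>
    have cross: "s u \<noteq> s v" if "u \<in> C" "v \<in> C" "{u, v} \<in> E" for u v
    proof
      assume eq: "s u = s v"
      have "attainable 4 E (\<lambda>x. \<delta> u x + \<delta> v x)"
        using finite_edges that(3) loopless[OF that(3)] by (rule attainable_edge)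
      moreover have "attainable 4 E (\<lambda>x. (\<delta> u x - s u * \<delta> r x) + (\<delta> v x - s v * \<delta> r x))"
        using attainable_combine[OF walk[OF that(1)] walk[OF that(2)], of 1 1] by simp
      ultimately have "attainable 4 E (\<lambda>x. s u * (\<delta> u x + \<delta> v x)
          + (- s u) * ((\<delta> u x - s u * \<delta> r x) + (\<delta> v x - s v * \<delta> r x)))"
        by (rule attainable_combine)
      moreover have "s u * (\<delta> u x + \<delta> v x)
          + (- s u) * ((\<delta> u x - s u * \<delta> r x) + (\<delta> v x - s v * \<delta> r x)) = 2 * \<delta> r x" for x
        using s[OF that(1)] eq by auto
      ultimately show False using False by simp
    qed
    show ?thesis
    proof (cases "induced_edges E C = {}")
      case True
      then show ?thesis
        by (intro exI[of _ "\<lambda>x. 0"]) (auto simp: attainable_zero induced_edges_def)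
    next
      case edge: False
      then obtain e where e: "e \<in> E" "e \<subseteq> C" by (auto simp: induced_edges_def)
      then obtain a b where ab: "e = {a, b}" "a \<noteq> b"
        using edge_card by (meson card_2_iff)
      have "C \<noteq> {a, b}"
      proof
        assume C: "C = {a, b}"
        have "e' = {a, b}" if "e' \<in> E" "e' \<subseteq> {a, b}" for e'
          using that edge_card[OF that(1)] ab(2) by (intro card_subset_eq) auto
        then have "induced_edges E C = {{a, b}}"
          using e ab(1) C by (auto simp: induced_edges_def)
        then show False using assms(3) C ab(2) by (auto simp: is_K2_def)
      qed
      then obtain c where c: "c \<in> C" "c \<noteq> a" "c \<noteq> b" using e(2) ab(1) by blast
      \<comment> \<open>Two of the three vertices \<open>a\<close>, \<open>b\<close>, \<open>c\<close> lie on the same side.\<close>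
      have "\<exists>x\<in>C. \<exists>y\<in>C. x \<noteq> y \<and> s x = s y"
        using c s[of a] s[of b] s[of c] ab e(2) by (metis insert_iff insert_subset singletonD)
      then obtain x y where "x \<in> C" "y \<in> C" "x \<noteq> y" "s x = s y" by blast
      from balanced_bipartite_target[OF \<open>finite C\<close> s this]
      obtain t where "4 dvd (\<Sum>v\<in>C. s v * t v)"
        "\<forall>u\<in>C. \<forall>v\<in>C. s u \<noteq> s v \<longrightarrow> \<not> [t u = t v] (mod 4)" by blast
      then show ?thesis using cross by (intro cut[of t] attainable_multiple) blast+
    qed
  qed
qed

section \<open>From residues to weights\<close>

lemma weighting_of_attainable:
  assumes "attainable (int k) E t" "k > 0"
  shows "\<exists>w. edge_weighting k E w \<and> (\<forall>u. [int (weighted_degree E w u) = t u] (mod (int k)))"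
proof -
  obtain w :: "'a set \<Rightarrow> int"
    where w: "\<And>u. [(\<Sum>e \<in> {e \<in> E. u \<in> e}. w e) = t u] (mod (int k))"
    using assms(1) unfolding attainable_def by blast
  \<comment> \<open>the shift by 1 turns the residue 0 into the weight \<open>k\<close>\<close>
  define w' where "w' e = nat ((w e - 1) mod int k) + 1" for e
  have int_w': "int (w' e) = (w e - 1) mod int k + 1" for e
    using assms(2) by (simp add: w'_def)
  have "edge_weighting k E w'"
    unfolding edge_weighting_def
  proof
    fix e
    have "(w e - 1) mod int k < int k" using assms(2) by simp
    then have "int (w' e) \<le> int k" unfolding int_w' by linarith
    then have "w' e \<le> k" by (simp only: of_nat_le_iff)
    then show "w' e \<in> {1..k}" by (simp add: w'_def)
  qed
  moreover have "[int (w' e) = w e] (mod (int k))" for e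
    unfolding int_w' cong_def by (simp add: mod_add_left_eq)
  then have "[int (weighted_degree E w' u) = (\<Sum>e \<in> {e \<in> E. u \<in> e}. w e)] (mod (int k))" for u
    unfolding weighted_degree_def of_nat_sum by (intro cong_sum)
  then have "[int (weighted_degree E w' u) = t u] (mod (int k))" for u
    using w cong_trans by blast
  ultimately show ?thesis by blast
qed

theorem theorem4p2:
  fixes V :: "'a set" and E :: "'a set set"
  assumes "simple_graph V E"
    and "nice V E"
    and "colorable 4 V E"
  shows "\<exists>w. edge_weighting 4 E w \<and> vertex_coloring_weighting E w"
proof -
  interpret simple_graph V E by fact
  let ?K = "components V E"
  define separates where "separates C t \<longleftrightarrow> attainable 4 E t \<and> (\<forall>x. x \<notin> C \<longrightarrow> t x = 0) \<and>
      (\<forall>u\<in>C. \<forall>v\<in>C. {u, v} \<in> E \<longrightarrow> \<not> [t u = t v] (mod 4))" for C t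
  have "\<forall>C\<in>?K. \<exists>t. separates C t"
    using component_target[OF assms(1)] assms(2,3) by (simp add: nice_def separates_def)
  then obtain t where t: "\<And>C. C \<in> ?K \<Longrightarrow> separates C (t C)" by metis
  have att: "attainable 4 E (t C)" if "C \<in> ?K" for C
    using t[OF that] by (simp add: separates_def)
  have out: "t C x = 0" if "C \<in> ?K" "x \<notin> C" for C x
    using t[OF that(1)] that(2) by (simp add: separates_def)
  have sep: "\<not> [t C u = t C v] (mod 4)" if "C \<in> ?K" "u \<in> C" "v \<in> C" "{u, v} \<in> E" for C u v
    using t[OF that(1)] that(2-4) by (simp add: separates_def)
  have fin: "finite ?K"
    unfolding components_def quotient_def using finite_vertices by simp
  define T where "T x = (\<Sum>C\<in>?K. t C x)" for x
  have T: "T x = t C x" if "C \<in> ?K" "x \<in> C" for C x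
  proof -
    have "x \<notin> C'" if "C' \<in> ?K - {C}" for C'
      using quotient_disj[OF equiv_linked, of C V E C'] \<open>C \<in> ?K\<close> \<open>x \<in> C\<close> that
      by (auto simp: components_def)
    then have "(\<Sum>C'\<in>?K - {C}. t C' x) = 0"
      using out by (intro sum.neutral) blast
    then show ?thesis
      unfolding T_def using sum.remove[OF fin \<open>C \<in> ?K\<close>, of "\<lambda>C. t C x"] by simp
  qed
  have "attainable (int 4) E T"
    unfolding T_def using fin att by (simp add: attainable_sum)
  from weighting_of_attainable[OF this] obtain w
    where w: "edge_weighting 4 E w" "\<And>u. [int (weighted_degree E w u) = T u] (mod 4)"
    by auto
  have "weighted_degree E w u \<noteq> weighted_degree E w v" if e: "{u, v} \<in> E" for u v
  proof -
    let ?C = "linked V E `` {u}"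
    have uv: "u \<in> V" "v \<in> V" using edge_subset[OF e] by auto
    have C: "?C \<in> ?K" unfolding components_def using uv(1) by (rule quotientI)
    have mem: "u \<in> ?C" "v \<in> ?C"
      using uv e by (auto simp: linked_def adjacency_def)
    have "\<not> [T u = T v] (mod 4)"
      using sep[OF C mem e] T[OF C] mem by simp
    then show ?thesis using w(2)[of u] w(2)[of v] by (metis cong_sym cong_trans)
  qed
  then show ?thesis
    using w(1) by (auto simp: vertex_coloring_weighting_def proper_coloring_def)
qed

end
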